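(* Let $(s_t,a_t)$ be a state-action pair with successor state $s_{t+1}$, and let $Z_\theta(s_t,a_t)$ be Gaussian with mean $Q_{\theta_1}(s_t,a_t)\in\mathbb R$ and standard deviation $\sigma_{\theta_2}(s_t,a_t)>0$. Let $\tilde Q, Q^*:\mathcal S\times\mathcal A\to\mathbb R$ be a noisy and an exact mean (Q-value) function, respectively, and define the noisy target and the exact target by $$\tilde Y(s_t,a_t):=r(s_t,a_t)+\gamma Z(s_{t+1},\tilde a),\quad \tilde a=\operatorname*{argmax}_{a\in\mathcal A}\tilde Q(s_{t+1},a),$$ $$Y^*(s_t,a_t):=r(s_t,a_t)+\gamma Z(s_{t+1},a^* ),\quad a^*=\operatorname*{argmax}_{a\in\mathcal A}Q^*(s_{t+1},a).$$ Define the noisy and exact gradient weights $$\tilde\Psi(s_t,a_t):=\frac{\partial}{\partial Q_{\theta_1}}d_e\big(Z_\theta(s_t,a_t),\tilde Y(s_t,a_t)\big),\qquad \Psi^*(s_t,a_t):=\frac{\partial}{\partial Q_{\theta_1}}d_e\big(Z_\theta(s_t,a_t),Y^*(s_t,a_t)\big),$$ where $\partial/\partial Q_{\theta_1}$ is the partial derivative with respect to the mean of $Z_\theta(s_t,a_t)$, the standard deviation and targets being held fixed, and the gradient weight error $\Delta\Psi_\theta(s_t,a_t):=|\tilde\Psi(s_t,a_t)-\Psi^*(s_t,a_t)|$. Then, with $Q_{\theta_1}(s_t,a_t)$ and the targets held fixed, $$\lim_{\sigma_{\theta_2}(s_t,a_t)\to\infty}\Delta\Psi_\theta(s_t,a_t)=0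 .$$
   Context: For real random variables (or laws) $U,V$ with cumulative distribution functions $F_U,F_V$, the energy distance (squared $L_2$ Cramér distance) is $d_e(U,V)=\int_{-\infty}^{\infty}(F_U(x)-F_V(x))^2\,dx$. Setting: a Markov decision process with state set $\mathcal S$, finite action set $\mathcal A$, real-valued reward $r(s,a)$ and discount factor $\gamma\in(0,1)$. The critic assigns to each $(s,a)$ a Gaussian distribution $Z_\theta(s,a)$ with mean $Q_{\theta_1}(s,a)$ and standard deviation $\sigma_{\theta_2}(s,a)$, $\theta=(\theta_1,\theta_2)$. The distribution $Z$ used in the targets is a fixed Gaussian value distribution for each $(s,a)$ (with positive standard deviation) that does not depend on $\theta$; hence $\tilde Y(s_t,a_t)$ and $Y^*(s_t,a_t)$ are fixed Gaussian distributions. *)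

theory Defs
  imports "HOL-Probability.Probability"
begin

definition gaussian :: "real \<Rightarrow> real \<Rightarrow> real measure" where
  "gaussian \<mu> \<sigma> = density lborel (\<lambda>x. ennreal (normal_density \<mu> \<sigma> x))"

definition energy_distance :: "real measure \<Rightarrow> real measure \<Rightarrow> real" where
  "energy_distance M N = (\<integral>x. (cdf M x - cdf N x)\<^sup>2 \<partial>lborel)"

text \<open>The law of \<open>r(s, a) + \<gamma> Z(s', b)\<close>, where \<open>Z(s', b)\<close> is given by its law and
  \<open>b\<close> is the greedy action selected in the successor state \<open>s'\<close>.\<close>

definition target ::
  "('s \<Rightarrow> 'a \<Rightarrow> real) \<Rightarrow> real \<Rightarrow> ('s \<Rightarrow> 'a \<Rightarrow> real measure) \<Rightarrow> 's \<Rightarrow> 'a \<Rightarrow> 's \<Rightarrow> 'a \<Rightarrow> real measure"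
where
  "target r \<gamma> Z s a s' b = distr (Z s' b) borel (\<lambda>z. r s a + \<gamma> * z)"

text \<open>The partial derivative with respect to the mean of the critic's Gaussian, evaluated at the
  mean \<open>q\<close>; the standard deviation \<open>\<sigma>\<close> and the target law \<open>Y\<close> are held fixed.\<close>

definition gradient_weight :: "real \<Rightarrow> real \<Rightarrow> real measure \<Rightarrow> real" where
  "gradient_weight q \<sigma> Y = deriv (\<lambda>m. energy_distance (gaussian m \<sigma>) Y) q"

definition gradient_weight_error ::
  "real \<Rightarrow> real \<Rightarrow> real measure \<Rightarrow> real measure \<Rightarrow> real"
where
  "gradient_weight_error q \<sigma> Y Y' = \<bar>gradient_weight q \<sigma> Y - gradient_weight q \<sigma> Y'\<bar>"

end

(*
  The derivative of d_e(N(m, sigma), Y) in m is -2 times the integral of phi * (F - F_Y), where phi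
  and F are the density and the cdf of N(m, sigma). The term with F does not involve the target, so
  it cancels in the difference of two gradient weights; after rescaling, the weight error is twice
  the absolute value of the integral of phi_std(z) * (F_Y(q + sigma z) - F_Y'(q + sigma z)), which
  vanishes as sigma grows because F_Y - F_Y' tends to 0 at both ends of the line.
*)

theory Submission
  imports Defs
begin

section \<open>Differentiation under the integral sign\<close>

text \<open>The mean value inequality turns the bound \<open>w\<close> on the derivatives into a
  bound on the difference quotients at \<open>q\<close>, and dominated convergence passes to the
  limit. The bound is assumed on a whole neighbourhood of \<open>q\<close> because the mean value
  inequality uses all intermediate points.\<close>

lemma has_real_derivative_integral_dominated:
  fixes f f' :: "real \<Rightarrow> 'a \<Rightarrow> real"
  assumes "0 < e"
    and integrable: "\<And>m. \<bar>m - q\<bar> \<le> e \<Longrightarrow> integrable M (f m)"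
    and deriv: "\<And>m x. \<bar>m - q\<bar> \<le> e \<Longrightarrow> x \<in> space M \<Longrightarrow>
      ((\<lambda>m. f m x) has_real_derivative f' m x) (at m)"
    and bound: "\<And>m x. \<bar>m - q\<bar> \<le> e \<Longrightarrow> x \<in> space M \<Longrightarrow> \<bar>f' m x\<bar> \<le> w x"
    and w: "integrable M w"
    and meas: "f' q \<in> borel_measurable M"
  shows "((\<lambda>m. \<integral>x. f m x \<partial>M) has_real_derivative (\<integral>x. f' q x \<partial>M)) (at q)"
proof -
  define D where "D = (\<lambda>m x. (f m x - f q x) / (m - q))"
  have intq: "integrable M (f q)"
    using integrable[of q] \<open>0 < e\<close> by simp
  have D_bound: "\<bar>D m x\<bar> \<le> w x" if m: "\<bar>m - q\<bar> \<le> e" and x: "x \<in> space M" for m x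
  proof -
    have "norm (f m x - f q x) \<le> w x * norm (m - q)"
    proof (rule field_differentiable_bound[where S="cball q e" and f'="\<lambda>m. f' m x"])
      fix z assume "z \<in> cball q e"
      then have z: "\<bar>z - q\<bar> \<le> e"
        by (simp add: dist_real_def abs_minus_commute)
      show "((\<lambda>m. f m x) has_field_derivative f' z x) (at z within cball q e)"
        using deriv[OF z x] by (rule has_field_derivative_at_within)
      show "norm (f' z x) \<le> w x"
        using bound[OF z x] by simp
    qed (use m \<open>0 < e\<close> in \<open>auto simp: dist_real_def abs_minus_commute\<close>)
    \<comment> \<open>For \<open>m = q\<close> division by zero makes \<open>D m x\<close> equal to
      \<open>0\<close>, so this case rests on \<open>w\<close> being nonnegative.\<close>
    moreover have "0 \<le> w x"
      using bound[OF m x] by linarith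
    ultimately show ?thesis
      by (cases "m = q") (auto simp: D_def field_simps)
  qed
  have "((\<lambda>m. \<integral>x. D m x \<partial>M) \<longlongrightarrow> (\<integral>x. f' q x \<partial>M)) (at q)"
    unfolding tendsto_at_iff_sequentially
  proof (intro allI impI)
    fix X :: "nat \<Rightarrow> real"
    assume X: "\<forall>i. X i \<in> UNIV - {q}" "X \<longlonglongrightarrow> q"
    from X(2) \<open>0 < e\<close> have "eventually (\<lambda>n. dist (X n) q < e) sequentially"
      by (rule tendstoD)
    \<comment> \<open>Dominated convergence asks for the bound at every index, so the first
      \<open>N\<close> terms are dropped; \<open>LIMSEQ_offset\<close> restores them.\<close>
    then obtain N where "\<And>n. n \<ge> N \<Longrightarrow> dist (X n) q < e"
      by (auto simp: eventually_sequentially)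
    then have N: "\<bar>X (n + N) - q\<bar> \<le> e" for n
      by (metis dist_real_def le_add2 less_imp_le)
    have XN: "filterlim (\<lambda>n. X (n + N)) (at q) sequentially"
      using LIMSEQ_ignore_initial_segment[OF X(2)] X(1) by (auto simp: filterlim_at)
    have "(\<lambda>n. \<integral>x. D (X (n + N)) x \<partial>M) \<longlonglongrightarrow> (\<integral>x. f' q x \<partial>M)"
    proof (rule integral_dominated_convergence[OF meas _ w])
      show "D (X (n + N)) \<in> borel_measurable M" for n
        unfolding D_def using integrable[OF N] intq by measurable
      show "AE x in M. norm (D (X (n + N)) x) \<le> w x" for n
        using D_bound[OF N] by auto
      show "AE x in M. (\<lambda>n. D (X (n + N)) x) \<longlonglongrightarrow> f' q x"
      proof (rule AE_I2)
        fix x assume "x \<in> space M"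
        then have "((\<lambda>m. D m x) \<longlongrightarrow> f' q x) (at q)"
          using deriv[of q x] \<open>0 < e\<close> unfolding D_def by (simp add: has_field_derivative_iff)
        from filterlim_compose[OF this XN] show "(\<lambda>n. D (X (n + N)) x) \<longlonglongrightarrow> f' q x" .
      qed
    qed
    then show "((\<lambda>m. \<integral>x. D m x \<partial>M) \<circ> X) \<longlonglongrightarrow> (\<integral>x. f' q x \<partial>M)"
      unfolding comp_def by (rule LIMSEQ_offset)
  qed
  \<comment> \<open>Linearity identifies the integral of \<open>D m\<close> with the difference
    quotient of the integrals, but only near \<open>q\<close>, where \<open>f m\<close> is known to
    be integrable.\<close>
  moreover have "eventually (\<lambda>m. (\<integral>x. D m x \<partial>M) = ((\<integral>x. f m x \<partial>M) - (\<integral>x. f q x \<partial>M)) / (m - q)) (at q)"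
    unfolding eventually_at
    using \<open>0 < e\<close> integrable intq by (auto simp: D_def dist_real_def intro!: exI[of _ e])
  ultimately have "((\<lambda>m. ((\<integral>x. f m x \<partial>M) - (\<integral>x. f q x \<partial>M)) / (m - q)) \<longlongrightarrow> (\<integral>x. f' q x \<partial>M)) (at q)"
    by (rule Lim_transform_eventually)
  then show ?thesis
    by (simp add: has_field_derivative_iff)
qed

section \<open>Distribution functions: tails and square integrability\<close>

lemma (in real_distribution) borel_measurable_cdf: "cdf M \<in> borel_measurable borel"
  by (intro borel_measurable_mono monoI cdf_nondecreasing)

text \<open>Markov's inequality in each tail: \<open>\<bar>x\<bar>\<close> times the indicator of
  the tail beyond \<open>x\<close> lies pointwise below the absolute value.\<close>

lemma (in real_distribution) markov_cdf:
  assumes "integrable M (\<lambda>x. x)"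
  shows markov_cdf_upper: "0 \<le> x \<Longrightarrow> x * (1 - cdf M x) \<le> expectation abs"
    and markov_cdf_lower: "x \<le> 0 \<Longrightarrow> \<bar>x\<bar> * cdf M x \<le> expectation abs"
proof -
  have abs: "integrable M (abs :: real \<Rightarrow> real)"
    using integrable_abs[OF assms] by simp
  show "x * (1 - cdf M x) \<le> expectation abs" if "0 \<le> x"
  proof -
    have "1 - cdf M x = prob {x<..}"
      using prob_compl[of "{..x}"] by (simp add: cdf_def Compl_eq_Diff_UNIV[symmetric] Compl_atMost)
    then have "x * (1 - cdf M x) = (\<integral>y. x * indicator {x<..} y \<partial>M)"
      by simp
    also have "\<dots> \<le> expectation abs"
      using that by (intro integral_mono abs integrable_mult_right integrable_real_indicator)
        (auto simp: indicator_def emeasure_eq_measure)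
    finally show ?thesis .
  qed
  show "\<bar>x\<bar> * cdf M x \<le> expectation abs" if "x \<le> 0"
  proof -
    have "\<bar>x\<bar> * cdf M x = (\<integral>y. \<bar>x\<bar> * indicator {..x} y \<partial>M)"
      by (simp add: cdf_def)
    also have "\<dots> \<le> expectation abs"
      using that by (intro integral_mono abs integrable_mult_right integrable_real_indicator)
        (auto simp: indicator_def emeasure_eq_measure)
    finally show ?thesis .
  qed
qed

lemma abs_cdf_diff_le_1:
  assumes "real_distribution M" "real_distribution N"
  shows "\<bar>cdf M x - cdf N x\<bar> \<le> 1"
proof -
  interpret M: real_distribution M by fact
  interpret N: real_distribution N by fact
  show ?thesis
    using M.cdf_nonneg[of x] N.cdf_nonneg[of x] M.cdf_bounded_prob[of x] N.cdf_bounded_prob[of x]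
    by linarith
qed

text \<open>First moments suffice: Markov's inequality makes the difference of the cdfs
  \<open>O(1 / \<bar>x\<bar>)\<close>, whose square is integrable.\<close>

lemma integrable_cdf_diff_square:
  assumes M: "real_distribution M" "integrable M (\<lambda>x. x)"
    and N: "real_distribution N" "integrable N (\<lambda>x. x)"
  shows "integrable lborel (\<lambda>x. (cdf M x - cdf N x)\<^sup>2)"
proof -
  interpret M: real_distribution M by fact
  interpret N: real_distribution N by fact
  define C where "C = M.expectation abs + N.expectation abs"
  have pos: "0 \<le> M.expectation abs" "0 \<le> N.expectation abs"
    by (simp_all add: integral_nonneg)
  \<comment> \<open>On the right half-line the difference of the cdfs is rewritten through the tails
    \<open>1 - cdf\<close>. On either side it is then a difference of two nonnegative terms, each
    bounded by a first absolute moment after multiplication by \<open>\<bar>x\<bar>\<close>.\<close>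
  have C: "\<bar>x * (cdf M x - cdf N x)\<bar> \<le> C" for x
  proof (cases "0 \<le> x")
    case True
    have "0 \<le> x * (1 - cdf M x)" "0 \<le> x * (1 - cdf N x)"
      using True M.cdf_bounded_prob[of x] N.cdf_bounded_prob[of x] by simp_all
    then show ?thesis
      using M.markov_cdf_upper[OF M(2) True] N.markov_cdf_upper[OF N(2) True] pos
      unfolding C_def right_diff_distrib by linarith
  next
    case False
    then have x: "x \<le> 0" by simp
    have "0 \<le> \<bar>x\<bar> * cdf M x" "0 \<le> \<bar>x\<bar> * cdf N x"
      using M.cdf_nonneg[of x] N.cdf_nonneg[of x] by simp_all
    then show ?thesis
      using M.markov_cdf_lower[OF M(2) x] N.markov_cdf_lower[OF N(2) x] pos x
      unfolding C_def right_diff_distrib by (simp add: abs_if split: if_splits)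
  qed
  \<comment> \<open>Adding the bound \<open>1\<close>, useful near the origin, to the bound
    \<open>C\<close>, useful in the tails, gives one integrable envelope on the whole line.\<close>
  have bound: "(cdf M x - cdf N x)\<^sup>2 \<le> (1 + C\<^sup>2) * inverse (1 + x\<^sup>2)" for x
  proof -
    have "(cdf M x - cdf N x)\<^sup>2 \<le> 1"
      using abs_cdf_diff_le_1[OF M(1) N(1)] by (simp add: abs_square_le_1)
    moreover have "(x * (cdf M x - cdf N x))\<^sup>2 \<le> C\<^sup>2"
      using power_mono[OF C, of x 2] by simp
    ultimately have "(cdf M x - cdf N x)\<^sup>2 * (1 + x\<^sup>2) \<le> 1 + C\<^sup>2"
      by (simp add: power_mult_distrib distrib_left mult.commute[of "x\<^sup>2"])
    moreover have "0 < 1 + x\<^sup>2"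
      by (simp add: add_pos_nonneg)
    ultimately show ?thesis
      by (simp add: field_simps)
  qed
  have "integrable lborel (\<lambda>x::real. inverse (1 + x\<^sup>2))"
    using integrable_inverse_1_plus_square by (simp add: set_integrable_def einterval_eq)
  then show ?thesis
  proof (rule Bochner_Integration.integrable_bound[OF integrable_mult_right[of "1 + C\<^sup>2"]])
    show "(\<lambda>x. (cdf M x - cdf N x)\<^sup>2) \<in> borel_measurable lborel"
      using M.borel_measurable_cdf N.borel_measurable_cdf by measurable
    have "norm ((cdf M x - cdf N x)\<^sup>2) \<le> norm ((1 + C\<^sup>2) * inverse (1 + x\<^sup>2))" for x
      using bound[of x] by (simp add: abs_mult add_nonneg_nonneg)
    then show "AE x in lborel. norm ((cdf M x - cdf N x)\<^sup>2) \<le> norm ((1 + C\<^sup>2) * inverse (1 + x\<^sup>2))"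
      by simp
  qed
qed

section \<open>Densities, cdfs and Gaussian laws\<close>

text \<open>Near \<open>x\<close> the cdf is a constant plus the integral of \<open>f\<close> from a
  fixed base point, so the fundamental theorem of calculus applies.\<close>

lemma cdf_density_has_real_derivative:
  fixes f :: "real \<Rightarrow> real"
  assumes "real_distribution (density lborel (\<lambda>x. ennreal (f x)))"
    and cont: "continuous_on UNIV f" and nonneg: "\<And>x. 0 \<le> f x"
  shows "(cdf (density lborel (\<lambda>x. ennreal (f x))) has_real_derivative f x) (at x)"
proof -
  let ?M = "density lborel (\<lambda>x. ennreal (f x))"
  interpret real_distribution ?M by fact
  have cont': "continuous_on S f" for S
    using cont by (rule continuous_on_subset) simp
  have [measurable]: "f \<in> borel_measurable borel"
    by (rule borel_measurable_continuous_onI[OF cont])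
  \<comment> \<open>The base point \<open>x - 1\<close> keeps the integral on a compact interval
    with \<open>x\<close> in its interior, so the one-sided derivatives of the endpoints never
    arise.\<close>
  have eq: "cdf ?M u = cdf ?M (x - 1) + integral {x - 1..u} f" if "u \<in> {x - 1<..<x + 1}" for u
  proof -
    have "set_integrable lborel {x - 1..u} f"
      by (rule borel_integrable_atLeastAtMost'[OF cont'])
    then have int: "set_integrable lborel {x - 1<..u} f"
      by (rule set_integrable_subset) auto
    have "cdf ?M u - cdf ?M (x - 1) = measure ?M {x - 1<..u}"
      using that by (intro cdf_diff_eq) simp
    also have "\<dots> = enn2real (\<integral>\<^sup>+y. ennreal (f y * indicator {x - 1<..u} y) \<partial>lborel)"
      unfolding measure_def
      by (subst emeasure_density) (auto simp: ennreal_mult' nonneg ennreal_indicator intro!: arg_cong[where f=enn2real] nn_integral_cong)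
    also have "\<dots> = (LBINT y:{x - 1<..u}. f y)"
      using int nonneg unfolding set_integrable_def set_lebesgue_integral_def
      by (subst nn_integral_eq_integral) (auto simp: mult.commute integral_nonneg)
    also have "\<dots> = integral {x - 1..u} f"
      using that interval_integral_eq_integral[of "x - 1" u f] borel_integrable_atLeastAtMost'[OF cont']
      by (simp add: interval_integral_Ioc)
    finally show ?thesis by simp
  qed
  have "((\<lambda>u. integral {x - 1..u} f) has_real_derivative f x) (at x within {x - 1..x + 1})"
    using integral_has_real_derivative[OF cont', of x "x - 1" "x + 1"] by simp
  then have "((\<lambda>u. integral {x - 1..u} f) has_real_derivative f x) (at x)"
    by (subst (asm) at_within_interior) auto
  then have "((\<lambda>u. cdf ?M (x - 1) + integral {x - 1..u} f) has_real_derivative f x) (at x)"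
    by (auto intro!: derivative_eq_intros)
  then show ?thesis
    by (rule has_field_derivative_transform_within_open[where S="{x - 1<..<x + 1}"])
      (auto simp: eq)
qed

lemma real_distribution_gaussian:
  assumes "0 < \<sigma>"
  shows "real_distribution (gaussian m \<sigma>)"
  unfolding real_distribution_def real_distribution_axioms_def gaussian_def
  using prob_space_normal_density[OF assms] by simp

lemma integrable_gaussian_id:
  assumes "0 < \<sigma>"
  shows "integrable (gaussian m \<sigma>) (\<lambda>x. x)"
  unfolding gaussian_def
  using integrable_normal_moment_nz_1[OF assms] by (subst integrable_density) auto

text \<open>Translation by \<open>m\<close> moves the mean into the argument of a fixed cdf, so that
  differentiating in the mean becomes differentiating in the argument, with a sign change.\<close>

lemma cdf_gaussian_shift: "cdf (gaussian m \<sigma>) x = cdf (gaussian 0 \<sigma>) (x - m)"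
proof -
  have "emeasure (gaussian m \<sigma>) {..x} =
      (\<integral>\<^sup>+y. ennreal (normal_density m \<sigma> y) * indicator {..x} y \<partial>lborel)"
    unfolding gaussian_def by (rule emeasure_density) auto
  also have "\<dots> = (\<integral>\<^sup>+y. ennreal (normal_density m \<sigma> (m + y)) * indicator {..x} (m + y) \<partial>lborel)"
    by (subst nn_integral_real_affine[of _ 1 m]) auto
  also have "\<dots> = (\<integral>\<^sup>+y. ennreal (normal_density 0 \<sigma> y) * indicator {..x - m} y \<partial>lborel)"
    by (intro nn_integral_cong) (auto simp: normal_density_def indicator_def)
  also have "\<dots> = emeasure (gaussian 0 \<sigma>) {..x - m}"
    unfolding gaussian_def by (rule emeasure_density[symmetric]) auto
  finally show ?thesis
    by (simp add: cdf_def measure_def)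
qed

lemma cdf_gaussian_has_real_derivative_mean:
  assumes "0 < \<sigma>"
  shows "((\<lambda>m. cdf (gaussian m \<sigma>) x) has_real_derivative - normal_density m \<sigma> x) (at m)"
proof -
  have "(cdf (gaussian 0 \<sigma>) has_real_derivative normal_density 0 \<sigma> (x - m)) (at (x - m))"
    unfolding gaussian_def
    by (intro cdf_density_has_real_derivative real_distribution_gaussian[OF assms, unfolded gaussian_def])
      (use assms in \<open>auto simp: normal_density_def intro!: continuous_intros\<close>)
  moreover have "((\<lambda>m. x - m) has_real_derivative -1) (at m)"
    by (auto intro!: derivative_eq_intros)
  ultimately have "((\<lambda>m. cdf (gaussian 0 \<sigma>) (x - m)) has_real_derivative
      normal_density 0 \<sigma> (x - m) * -1) (at m)"
    by (rule DERIV_chain2)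
  then show ?thesis
    unfolding cdf_gaussian_shift[of _ _ x] by (simp add: normal_density_def)
qed

text \<open>Provides one integrable majorant for all means within \<open>1\<close> of
  \<open>q\<close>. Doubling the variance leaves room in the exponent to absorb the shift of the
  mean up to the factor \<open>exp (1 / (2 * \<sigma>\<^sup>2))\<close>; \<open>sqrt 2\<close> is
  the ratio of the normalising constants.\<close>

lemma normal_density_le_wider:
  assumes "0 < \<sigma>" and "\<bar>m - q\<bar> \<le> 1"
  shows "normal_density m \<sigma> x \<le> sqrt 2 * exp (1 / (2 * \<sigma>\<^sup>2)) * normal_density q (sqrt 2 * \<sigma>) x"
proof -
  have "0 \<le> (x - 2 * m + q)\<^sup>2"
    by simp
  moreover have "(m - q)\<^sup>2 \<le> 1"
    using assms(2) by (simp add: abs_square_le_1)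
  \<comment> \<open>The parallelogram identity for \<open>x - m\<close> and \<open>m - q\<close>,
    whose sum is \<open>x - q\<close> and whose difference is \<open>x - 2 * m + q\<close>.\<close>
  moreover have "2 * (x - m)\<^sup>2 + 2 * (m - q)\<^sup>2 - (x - q)\<^sup>2 = (x - 2 * m + q)\<^sup>2"
    by (simp add: power2_eq_square algebra_simps)
  ultimately have "(x - q)\<^sup>2 \<le> 2 * (x - m)\<^sup>2 + 2"
    by linarith
  then have "- (x - m)\<^sup>2 / (2 * \<sigma>\<^sup>2) \<le> 1 / (2 * \<sigma>\<^sup>2) + - (x - q)\<^sup>2 / (4 * \<sigma>\<^sup>2)"
    using assms(1) by (simp add: field_simps)
  then have "exp (- (x - m)\<^sup>2 / (2 * \<sigma>\<^sup>2)) \<le> exp (1 / (2 * \<sigma>\<^sup>2)) * exp (- (x - q)\<^sup>2 / (4 * \<sigma>\<^sup>2))"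
    by (simp add: exp_add[symmetric])
  then have "exp (- (x - m)\<^sup>2 / (2 * \<sigma>\<^sup>2)) / sqrt (2 * pi * \<sigma>\<^sup>2)
      \<le> exp (1 / (2 * \<sigma>\<^sup>2)) * exp (- (x - q)\<^sup>2 / (4 * \<sigma>\<^sup>2)) / sqrt (2 * pi * \<sigma>\<^sup>2)"
    by (rule divide_right_mono) simp
  also have "\<dots> = exp (1 / (2 * \<sigma>\<^sup>2)) * (exp (- (x - q)\<^sup>2 / (4 * \<sigma>\<^sup>2)) / sqrt (2 * pi * \<sigma>\<^sup>2))"
    by simp
  also have "exp (- (x - q)\<^sup>2 / (4 * \<sigma>\<^sup>2)) / sqrt (2 * pi * \<sigma>\<^sup>2) = sqrt 2 * normal_density q (sqrt 2 * \<sigma>) x"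
    using assms(1) by (simp add: normal_density_def power_mult_distrib real_sqrt_mult field_simps)
  finally show ?thesis
    by (simp add: normal_density_def[of m] mult_ac)
qed

section \<open>The gradient weight of the energy distance\<close>

text \<open>Two cdfs differ by at most \<open>1\<close>, so the derivative of the integrand is at
  most twice the Gaussian density, and the wider Gaussian dominates that uniformly in the mean. This
  also shows that the \<open>deriv\<close> in \<open>gradient_weight\<close> is a genuine
  derivative.\<close>

lemma energy_distance_gaussian_has_real_derivative:
  assumes "0 < \<sigma>" and Y: "real_distribution Y" "integrable Y (\<lambda>x. x)"
  shows "((\<lambda>m. energy_distance (gaussian m \<sigma>) Y) has_real_derivative
      (\<integral>x. - 2 * (normal_density q \<sigma> x * (cdf (gaussian q \<sigma>) x - cdf Y x)) \<partial>lborel)) (at q)"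
  unfolding energy_distance_def
proof (rule has_real_derivative_integral_dominated[where e=1 and
      f'="\<lambda>m x. - 2 * (normal_density m \<sigma> x * (cdf (gaussian m \<sigma>) x - cdf Y x))" and
      w="\<lambda>x. 2 * (sqrt 2 * exp (1 / (2 * \<sigma>\<^sup>2)) * normal_density q (sqrt 2 * \<sigma>) x)"])
  note G = real_distribution_gaussian[OF assms(1)]
  fix m x :: real
  assume m: "\<bar>m - q\<bar> \<le> 1"
  show "integrable lborel (\<lambda>x. (cdf (gaussian m \<sigma>) x - cdf Y x)\<^sup>2)"
    by (intro integrable_cdf_diff_square G Y integrable_gaussian_id assms(1))
  show "((\<lambda>m. (cdf (gaussian m \<sigma>) x - cdf Y x)\<^sup>2) has_real_derivative
      - 2 * (normal_density m \<sigma> x * (cdf (gaussian m \<sigma>) x - cdf Y x))) (at m)"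
    by (rule derivative_eq_intros cdf_gaussian_has_real_derivative_mean[OF assms(1)] refl)+ simp
  have "normal_density m \<sigma> x * \<bar>cdf (gaussian m \<sigma>) x - cdf Y x\<bar> \<le> normal_density m \<sigma> x * 1"
    by (intro mult_left_mono abs_cdf_diff_le_1 G Y) simp
  also note normal_density_le_wider[OF assms(1) m]
  finally show "\<bar>- 2 * (normal_density m \<sigma> x * (cdf (gaussian m \<sigma>) x - cdf Y x))\<bar>
      \<le> 2 * (sqrt 2 * exp (1 / (2 * \<sigma>\<^sup>2)) * normal_density q (sqrt 2 * \<sigma>) x)"
    by (simp add: abs_mult)
next
  show "integrable lborel (\<lambda>x. 2 * (sqrt 2 * exp (1 / (2 * \<sigma>\<^sup>2)) * normal_density q (sqrt 2 * \<sigma>) x))"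
    using assms(1) by (intro integrable_mult_right integrable_normal_density) simp
  show "(\<lambda>x. - 2 * (normal_density q \<sigma> x * (cdf (gaussian q \<sigma>) x - cdf Y x))) \<in> borel_measurable lborel"
    using real_distribution.borel_measurable_cdf[OF real_distribution_gaussian[OF assms(1)]]
      real_distribution.borel_measurable_cdf[OF Y(1)] by measurable
qed simp

lemma integrable_normal_density_mult_cdf_diff:
  assumes "0 < \<sigma>" "real_distribution M" "real_distribution N"
  shows "integrable lborel (\<lambda>x. normal_density q \<sigma> x * (cdf M x - cdf N x))"
proof (rule Bochner_Integration.integrable_bound[OF integrable_normal_density[OF assms(1)]])
  show "(\<lambda>x. normal_density q \<sigma> x * (cdf M x - cdf N x)) \<in> borel_measurable lborel"
    using real_distribution.borel_measurable_cdf[OF assms(2)]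
      real_distribution.borel_measurable_cdf[OF assms(3)] by measurable
  have "\<bar>normal_density q \<sigma> x * (cdf M x - cdf N x)\<bar> \<le> normal_density q \<sigma> x" for x
    using mult_left_mono[OF abs_cdf_diff_le_1[OF assms(2,3)], of "normal_density q \<sigma> x" x]
    by (simp add: abs_mult)
  then show "AE x in lborel. norm (normal_density q \<sigma> x * (cdf M x - cdf N x)) \<le> norm (normal_density q \<sigma> x)"
    by simp
qed

text \<open>The terms with the critic's own cdf cancel, and the substitution
  \<open>x = q + \<sigma> * z\<close> moves \<open>\<sigma>\<close> from the density into the target
  cdfs. The weight left over is independent of \<open>\<sigma>\<close>, as dominated convergence
  will require.\<close>

lemma gradient_weight_diff:
  assumes \<sigma>: "0 < \<sigma>"
    and Y: "real_distribution Y" "integrable Y (\<lambda>x. x)"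
    and Y': "real_distribution Y'" "integrable Y' (\<lambda>x. x)"
  shows "gradient_weight q \<sigma> Y - gradient_weight q \<sigma> Y' =
    2 * (\<integral>z. std_normal_density z * (cdf Y (q + \<sigma> * z) - cdf Y' (q + \<sigma> * z)) \<partial>lborel)"
proof -
  note G = real_distribution_gaussian[OF \<sigma>, of q]
  have "gradient_weight q \<sigma> Y - gradient_weight q \<sigma> Y' =
      (\<integral>x. - 2 * (normal_density q \<sigma> x * (cdf (gaussian q \<sigma>) x - cdf Y x)) \<partial>lborel) -
      (\<integral>x. - 2 * (normal_density q \<sigma> x * (cdf (gaussian q \<sigma>) x - cdf Y' x)) \<partial>lborel)"
    unfolding gradient_weight_def
    using energy_distance_gaussian_has_real_derivative[OF \<sigma> Y, THEN DERIV_imp_deriv]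
      energy_distance_gaussian_has_real_derivative[OF \<sigma> Y', THEN DERIV_imp_deriv] by simp
  also have "\<dots> = (\<integral>x. 2 * (normal_density q \<sigma> x * (cdf Y x - cdf Y' x)) \<partial>lborel)"
    by (subst Bochner_Integration.integral_diff[symmetric],
        (intro integrable_mult_right integrable_normal_density_mult_cdf_diff G Y Y' \<sigma>)+,
        intro Bochner_Integration.integral_cong refl, simp only: algebra_simps)
  also have "\<dots> = 2 * (\<integral>x. normal_density q \<sigma> x * (cdf Y x - cdf Y' x) \<partial>lborel)"
    by simp
  also have "(\<integral>x. normal_density q \<sigma> x * (cdf Y x - cdf Y' x) \<partial>lborel) =
      \<sigma> * (\<integral>z. normal_density q \<sigma> (q + \<sigma> * z) * (cdf Y (q + \<sigma> * z) - cdf Y' (q + \<sigma> * z)) \<partial>lborel)"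
    using lborel_integral_real_affine[of \<sigma> "\<lambda>x. normal_density q \<sigma> x * (cdf Y x - cdf Y' x)" q] \<sigma>
    by simp
  also have "\<dots> = (\<integral>z. \<sigma> * (normal_density q \<sigma> (q + \<sigma> * z) * (cdf Y (q + \<sigma> * z) - cdf Y' (q + \<sigma> * z))) \<partial>lborel)"
    by simp
  also have "\<dots> = (\<integral>z. std_normal_density z * (cdf Y (q + \<sigma> * z) - cdf Y' (q + \<sigma> * z)) \<partial>lborel)"
  proof (intro Bochner_Integration.integral_cong refl)
    fix z
    \<comment> \<open>The Jacobian factor \<open>\<sigma>\<close> cancels the
      \<open>1 / \<sigma>\<close> in the normalisation of the density.\<close>
    have "\<sigma> * normal_density q \<sigma> (q + \<sigma> * z) = std_normal_density z"
      using \<sigma> by (simp add: normal_density_def real_sqrt_mult power_mult_distrib)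
    then show "\<sigma> * (normal_density q \<sigma> (q + \<sigma> * z) * (cdf Y (q + \<sigma> * z) - cdf Y' (q + \<sigma> * z))) =
        std_normal_density z * (cdf Y (q + \<sigma> * z) - cdf Y' (q + \<sigma> * z))"
      by (simp add: mult.assoc[symmetric])
  qed
  finally show ?thesis .
qed

section \<open>The limit of large standard deviation\<close>

lemma gradient_weight_error_tendsto_0:
  assumes Y: "real_distribution Y" "integrable Y (\<lambda>x. x)"
    and Y': "real_distribution Y'" "integrable Y' (\<lambda>x. x)"
  shows "((\<lambda>\<sigma>. gradient_weight_error q \<sigma> Y Y') \<longlongrightarrow> 0) at_top"
proof -
  interpret Y: real_distribution Y by fact
  interpret Y': real_distribution Y' by fact
  note [measurable] = Y.borel_measurable_cdf Y'.borel_measurable_cdf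
  define D where "D = (\<lambda>x. cdf Y x - cdf Y' x)"
  \<comment> \<open>Both cdfs tend to \<open>1\<close> at the right end and to \<open>0\<close> at
    the left end.\<close>
  have D_lim: "(D \<longlongrightarrow> 0) at_infinity"
    unfolding at_infinity_eq_at_top_bot D_def
    using tendsto_diff[OF Y.cdf_lim_at_top_prob Y'.cdf_lim_at_top_prob]
      tendsto_diff[OF Y.cdf_lim_at_bot Y'.cdf_lim_at_bot]
    by (simp add: filterlim_sup)
  have "((\<lambda>\<sigma>. \<integral>z. std_normal_density z * D (q + \<sigma> * z) \<partial>lborel) \<longlongrightarrow> (\<integral>z. 0 \<partial>(lborel :: real measure))) at_top"
  proof (rule integral_dominated_convergence_at_top[where w=std_normal_density])
    show "\<forall>\<^sub>F \<sigma> in at_top. AE z in lborel. norm (std_normal_density z * D (q + \<sigma> * z)) \<le> std_normal_density z"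
      using abs_cdf_diff_le_1[OF Y(1) Y'(1)]
      by (intro always_eventually allI AE_I2) (simp add: D_def abs_mult mult_left_le)
    \<comment> \<open>The point \<open>z = 0\<close> has to be left out: there the argument stays at
      \<open>q\<close>, where \<open>D\<close> may be nonzero. For every other \<open>z\<close> it
      escapes to infinity, to the left or to the right according to the sign of
      \<open>z\<close>.\<close>
    show "AE z in lborel. ((\<lambda>\<sigma>. std_normal_density z * D (q + \<sigma> * z)) \<longlongrightarrow> 0) at_top"
      using AE_lborel_singleton[of "0::real"]
    proof eventually_elim
      fix z :: real assume z: "z \<noteq> 0"
      have "filterlim (\<lambda>\<sigma>. \<sigma> * z) at_infinity at_top"
        using tendsto_mult_filterlim_at_infinity[OF tendsto_const z filterlim_at_top_imp_at_infinity[OF filterlim_ident]]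
        by (simp add: mult.commute)
      then have "filterlim (\<lambda>\<sigma>. q + \<sigma> * z) at_infinity at_top"
        by (rule tendsto_add_filterlim_at_infinity[OF tendsto_const])
      from tendsto_mult_right_zero[OF filterlim_compose[OF D_lim this]]
      show "((\<lambda>\<sigma>. std_normal_density z * D (q + \<sigma> * z)) \<longlongrightarrow> 0) at_top" .
    qed
  qed (auto simp: D_def)
  then have "((\<lambda>\<sigma>. \<bar>2 * (\<integral>z. std_normal_density z * D (q + \<sigma> * z) \<partial>lborel)\<bar>) \<longlongrightarrow> 0) at_top"
    by (intro tendsto_rabs_zero tendsto_mult_right_zero) simp
  \<comment> \<open>The integral formula for the weights is available for positive
    \<open>\<sigma>\<close> only, hence the eventual equality.\<close>
  moreover have "\<forall>\<^sub>F \<sigma> in at_top. \<bar>2 * (\<integral>z. std_normal_density z * D (q + \<sigma> * z) \<partial>lborel)\<bar> =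
      gradient_weight_error q \<sigma> Y Y'"
    using eventually_gt_at_top[of 0]
    by eventually_elim (simp add: gradient_weight_error_def gradient_weight_diff[OF _ Y Y'] D_def)
  ultimately show ?thesis
    by (rule Lim_transform_eventually)
qed

section \<open>The targets and the conclusion\<close>

text \<open>Both properties pass through the affine push-forward: the map is measurable, and an
  affine function of a variable with finite first moment is integrable.\<close>

lemma target_regular:
  assumes "0 < \<tau>" and "Z s' b = gaussian \<mu> \<tau>"
  shows real_distribution_target: "real_distribution (target r \<gamma> Z s a s' b)"
    and integrable_target_id: "integrable (target r \<gamma> Z s a s' b) (\<lambda>x. x)"
proof -
  interpret G: real_distribution "gaussian \<mu> \<tau>"
    by (rule real_distribution_gaussian[OF assms(1)])
  have "(\<lambda>z. r s a + \<gamma> * z) \<in> borel_measurable (gaussian \<mu> \<tau>)"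
    by simp
  then show "real_distribution (target r \<gamma> Z s a s' b)"
    unfolding target_def assms(2) by (rule G.real_distribution_distr)
  show "integrable (target r \<gamma> Z s a s' b) (\<lambda>x. x)"
    unfolding target_def assms(2)
    by (subst integrable_distr_eq) (auto intro!: integrable_gaussian_id assms(1))
qed

text \<open>The greedy actions enter through \<open>is_arg_max\<close>, so every way of breaking
  ties is covered.\<close>

theorem proposition5p4:
  fixes S :: "'s set" and A :: "'a set"
    and r :: "'s \<Rightarrow> 'a \<Rightarrow> real" and \<gamma> :: real
    and Z :: "'s \<Rightarrow> 'a \<Rightarrow> real measure"
    and Q Q_noisy Q_exact :: "'s \<Rightarrow> 'a \<Rightarrow> real"
    and s s' :: 's and a a_noisy a_exact :: 'a
  assumes "finite A"
    and "0 < \<gamma>" and "\<gamma> < 1"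
    and "\<And>x b. x \<in> S \<Longrightarrow> b \<in> A \<Longrightarrow> \<exists>\<mu> \<tau>. \<tau> > 0 \<and> Z x b = gaussian \<mu> \<tau>"
    and "s \<in> S" and "a \<in> A" and "s' \<in> S"
    and "is_arg_max (Q_noisy s') (\<lambda>b. b \<in> A) a_noisy"
    and "is_arg_max (Q_exact s') (\<lambda>b. b \<in> A) a_exact"
  shows "((\<lambda>\<sigma>. gradient_weight_error (Q s a) \<sigma>
            (target r \<gamma> Z s a s' a_noisy) (target r \<gamma> Z s a s' a_exact)) \<longlongrightarrow> 0) at_top"
proof -
  \<comment> \<open>Stated for an arbitrary score \<open>f\<close> to serve the noisy and the exact
    action alike; of the maximiser it uses membership in \<open>A\<close>, which makes its value
    distribution Gaussian.\<close>
  have target: "real_distribution (target r \<gamma> Z s a s' b) \<and> integrable (target r \<gamma> Z s a s' b) (\<lambda>x. x)"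
    if "is_arg_max f (\<lambda>b. b \<in> A) b" for f :: "'a \<Rightarrow> real" and b
  proof -
    have "b \<in> A"
      using that by (simp add: is_arg_max_def)
    with assms(4)[OF \<open>s' \<in> S\<close>] obtain \<mu> \<tau> where "0 < \<tau>" "Z s' b = gaussian \<mu> \<tau>"
      by blast
    then show ?thesis
      by (blast intro: real_distribution_target integrable_target_id)
  qed
  show ?thesis
    using target[OF assms(8)] target[OF assms(9)] by (intro gradient_weight_error_tendsto_0) auto
qed

end
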